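(* Let $i\ge 0$ and let $K$ be an $(i+1)$-path connected finite simplicial complex. Then the following are equivalent: (1) the $i$-th signed incidence graph $B_i(K)$ (with respect to any orientation of $K$) is balanced; (2) $K$ contains no $(i+1)$-orientable circuit of odd length and no $(i+1)$-non-orientable circuit of even length.
   Context: A simplicial complex $K$ is a finite collection of subsets of a vertex set closed under taking subsets; an $i$-face has $i+1$ elements, $S_i(K)$ is the set of $i$-faces. An orientation assigns each face an ordering of its vertices up to even permutations. For an oriented $(i+1)$-face $[\bar F]=[v_0,\dots,v_{i+1}]$ and $F=\bar F\setminus\{v_j\}$, $\operatorname{sgn}([F],\partial[\bar F])=(-1)^j$ if the orientation of $F$ agrees with $[v_0,\dots,\hat v_j,\dots,v_{i+1}]$, and $-(-1)^j$ otherwise. The $i$-th signed incidence graph $B_i(K)$ is the bipartite graph on $S_i(K)\cup S_{i+1}(K)$ with an edge $\{F,\bar F\}$ iff $F\subset\bar F$, signed by $\operatorname{sgn}([F],\partial[\bar F])$; it is balanced if every cycle has positive product of signs (this does not depend on the orientation chosen). An $(i+1)$-path of length $m$ is a sequence of $(i+1)$-faces $\bar F_1,\dots,\bar F_m$ such that $\bar F_j\cap\bar F_l$ is an $i$-face if and only if $|j-l|=1$; $K$ is $(i+1)$-path connected if any two $(i+1)$-faces are joined by an $(i+1)$-path. When $\bar F_m$ coincides with $\bar F_1$, the sequence is called an $(i+1)$-circuit of length $m-1$ (consecutive faces, cyclically, share an $i$-face). A pure $(i+1)$-dimensional complex is orientable if one can orient all its $(i+1)$-faces so that any two $(i+1)$-faces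 meeting in an $i$-face induce opposite orientations on that $i$-face; an $(i+1)$-circuit is called orientable or non-orientable according to whether the pure $(i+1)$-dimensional complex formed by its faces is orientable in this sense. *)

theory Defs
  imports "HOL-Combinatorics.Combinatorics"
begin

section \<open>Simplicial complexes\<close>

text \<open>Closure under subsets together with finiteness of \<open>K\<close> forces every face to be finite.\<close>

definition simplicial_complex :: "'a set set \<Rightarrow> bool" where
  "simplicial_complex K \<longleftrightarrow> finite K \<and> (\<forall>F\<in>K. \<forall>G. G \<subseteq> F \<longrightarrow> G \<in> K)"

definition faces :: "nat \<Rightarrow> 'a set set \<Rightarrow> 'a set set" where
  "faces i K = {F \<in> K. card F = i + 1}"

section \<open>Orientations and incidence signs\<close>

definition even_perm_rel :: "'a set \<Rightarrow> ('a list \<times> 'a list) set" where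
  "even_perm_rel F =
     {(xs, ys). xs \<in> permutations_of_set F \<and> ys \<in> permutations_of_set F \<and>
                (\<exists>\<pi>. \<pi> permutes F \<and> evenperm \<pi> \<and> ys = map \<pi> xs)}"

definition face_orientations :: "'a set \<Rightarrow> 'a list set set" where
  "face_orientations F = permutations_of_set F // even_perm_rel F"

definition orientation :: "'a set set \<Rightarrow> ('a set \<Rightarrow> 'a list set) \<Rightarrow> bool" where
  "orientation K \<omega> \<longleftrightarrow> (\<forall>F\<in>K. \<omega> F \<in> face_orientations F)"

text \<open>
  The sign of \<open>F\<close> in the boundary of \<open>G\<close>, where \<open>F\<close> arises from \<open>G\<close> by deleting one vertex.
  The value does not depend on which ordering \<open>vs\<close> representing the orientation of \<open>G\<close> is picked.
\<close>

definition incidence_sign :: "('a set \<Rightarrow> 'a list set) \<Rightarrow> 'a set \<Rightarrow> 'a set \<Rightarrow> int" where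
  "incidence_sign \<omega> F G =
     (let vs = (SOME vs. vs \<in> \<omega> G);
          j = (THE j. j < length vs \<and> F = G - {vs ! j})
      in if take j vs @ drop (Suc j) vs \<in> \<omega> F then (- 1) ^ j else - ((- 1) ^ j))"

section \<open>Signed graphs\<close>

record 'v signed_graph =
  verts :: "'v set"
  edges :: "'v set set"
  edge_sign :: "'v set \<Rightarrow> int"

text \<open>A cycle is given by the list of its vertices, without repeating the first one at the end.\<close>

definition is_cycle :: "'v signed_graph \<Rightarrow> 'v list \<Rightarrow> bool" where
  "is_cycle \<Gamma> c \<longleftrightarrow>
     3 \<le> length c \<and> distinct c \<and> set c \<subseteq> verts \<Gamma> \<and>
     (\<forall>k < length c. {c ! k, c ! (Suc k mod length c)} \<in> edges \<Gamma>)"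

definition cycle_sign :: "'v signed_graph \<Rightarrow> 'v list \<Rightarrow> int" where
  "cycle_sign \<Gamma> c = (\<Prod>k < length c. edge_sign \<Gamma> {c ! k, c ! (Suc k mod length c)})"

definition balanced :: "'v signed_graph \<Rightarrow> bool" where
  "balanced \<Gamma> \<longleftrightarrow> (\<forall>c. is_cycle \<Gamma> c \<longrightarrow> cycle_sign \<Gamma> c > 0)"

text \<open>
  An edge \<open>e = {F, G}\<close> with \<open>F \<subset> G\<close> has \<open>\<Inter>e = F\<close> and \<open>\<Union>e = G\<close>, so its sign
  is \<open>incidence_sign \<omega> F G\<close>.
\<close>

definition signed_incidence_graph ::
    "nat \<Rightarrow> 'a set set \<Rightarrow> ('a set \<Rightarrow> 'a list set) \<Rightarrow> 'a set signed_graph" where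
  "signed_incidence_graph i K \<omega> =
     \<lparr> verts = faces i K \<union> faces (i + 1) K,
       edges = {{F, G} |F G. F \<in> faces i K \<and> G \<in> faces (i + 1) K \<and> F \<subset> G},
       edge_sign = (\<lambda>e. incidence_sign \<omega> (\<Inter>e) (\<Union>e)) \<rparr>"

section \<open>Paths and circuits of (i+1)-faces\<close>

definition face_path :: "nat \<Rightarrow> 'a set set \<Rightarrow> 'a set list \<Rightarrow> bool" where
  "face_path i K Fs \<longleftrightarrow>
     Fs \<noteq> [] \<and> set Fs \<subseteq> faces (i + 1) K \<and>
     (\<forall>j < length Fs. \<forall>l < length Fs.
        Fs ! j \<inter> Fs ! l \<in> faces i K \<longleftrightarrow> (l = Suc j \<or> j = Suc l))"

definition face_path_connected :: "nat \<Rightarrow> 'a set set \<Rightarrow> bool" where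
  "face_path_connected i K \<longleftrightarrow>
     (\<forall>F \<in> faces (i + 1) K. \<forall>G \<in> faces (i + 1) K.
        \<exists>Fs. face_path i K Fs \<and> hd Fs = F \<and> last Fs = G)"

text \<open>
  A circuit \<open>F\<^sub>1, \<dots>, F\<^sub>m\<close> with \<open>F\<^sub>m = F\<^sub>1\<close> is given by the list
  \<open>[F\<^sub>1, \<dots>, F\<^bsub>m-1\<^esub>]\<close>, whose length \<open>m - 1\<close> is the length of the circuit. The condition
  \<open>|j - l| = 1\<close> on paths is read cyclically: exactly the cyclically consecutive faces meet
  in an i-face.
\<close>

definition face_circuit :: "nat \<Rightarrow> 'a set set \<Rightarrow> 'a set list \<Rightarrow> bool" where
  "face_circuit i K Fs \<longleftrightarrow>
     Fs \<noteq> [] \<and> set Fs \<subseteq> faces (i + 1) K \<and>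
     (\<forall>j < length Fs. \<forall>l < length Fs.
        Fs ! j \<inter> Fs ! l \<in> faces i K \<longleftrightarrow>
          (l = Suc j mod length Fs \<or> j = Suc l mod length Fs))"

section \<open>Orientability\<close>

definition generated_complex :: "'a set set \<Rightarrow> 'a set set" where
  "generated_complex \<F> = {G. \<exists>F\<in>\<F>. G \<subseteq> F}"

text \<open>
  For a pure complex \<open>L\<close> of dimension \<open>i + 1\<close>. The orientations that \<open>F\<close> and \<open>G\<close> induce on the
  common i-face \<open>F \<inter> G\<close> are compared through their signs relative to \<open>\<omega> (F \<inter> G)\<close>; whether
  these are opposite does not depend on \<open>\<omega> (F \<inter> G)\<close>. Signs are needed since a vertex has only
  one ordering, so that opposite orientations of it are not distinguished by ordering classes.
\<close>

definition orientable :: "nat \<Rightarrow> 'a set set \<Rightarrow> bool" where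
  "orientable i L \<longleftrightarrow>
     (\<exists>\<omega>. orientation L \<omega> \<and>
        (\<forall>F \<in> faces (i + 1) L. \<forall>G \<in> faces (i + 1) L. F \<inter> G \<in> faces i L \<longrightarrow>
           incidence_sign \<omega> (F \<inter> G) F = - incidence_sign \<omega> (F \<inter> G) G))"

definition orientable_circuit :: "nat \<Rightarrow> 'a set set \<Rightarrow> 'a set list \<Rightarrow> bool" where
  "orientable_circuit i K Fs \<longleftrightarrow>
     face_circuit i K Fs \<and> orientable i (generated_complex (set Fs))"

definition non_orientable_circuit :: "nat \<Rightarrow> 'a set set \<Rightarrow> 'a set list \<Rightarrow> bool" where
  "non_orientable_circuit i K Fs \<longleftrightarrow>
     face_circuit i K Fs \<and> \<not> orientable i (generated_complex (set Fs))"

end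

theory Submission
  imports Defs
begin

text \<open>
  Both sides are equivalent to the existence of a sign \<open>p\<close> on all faces such that the incidence
  sign of every pair \<open>E \<subset> F\<close> is \<open>p E * p F\<close>. For balance this is Harary's theorem: a shortest
  negative closed walk in a signed graph has no repeated vertex and hence is a cycle, and if there
  is no such walk, then signs of walks from a root define \<open>p\<close>.

  Given \<open>p\<close>, twisting the orientation of each top face \<open>F\<close> by \<open>p F\<close> makes any two adjacent
  faces induce the same orientation on their intersection, so a circuit is orientable iff
  it can be 2-coloured, that is, iff its length is even. Conversely, if there is no \<open>p\<close>, then some
  closed walk through the top faces is negative. A shortest one has no chords and is therefore a
  circuit; it has odd length iff it is orientable, because reversing the sign of all \<open>n\<close> steps
  changes its sign by \<open>(- 1) ^ n\<close>.
\<close>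

section \<open>Orderings up to even permutations\<close>

text \<open>Also \<open>- 1\<close> if \<open>ys\<close> is not a rearrangement of \<open>xs\<close>.\<close>

definition list_sign :: "'a list \<Rightarrow> 'a list \<Rightarrow> int" where
  "list_sign xs ys =
     (if \<exists>\<pi>. \<pi> permutes set xs \<and> evenperm \<pi> \<and> ys = map \<pi> xs then 1 else - 1)"

lemma list_sign_cases: "list_sign xs ys = 1 \<or> list_sign xs ys = - 1"
  by (simp add: list_sign_def)

text \<open>Permutations of \<open>set xs\<close> that agree on the entries of \<open>xs\<close> are
  equal, so \<open>\<pi>\<close> is the only candidate for the existential in
  \<open>list_sign\<close>.\<close>

lemma list_sign_map:
  assumes "\<pi> permutes set xs"
  shows "list_sign xs (map \<pi> xs) = sign \<pi>"
proof -
  have "evenperm \<pi>" if "\<rho> permutes set xs" "evenperm \<rho>" "map \<pi> xs = map \<rho> xs" for \<rho>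
  proof -
    have "\<rho> x = \<pi> x" for x
      using that(1,3) assms by (cases "x \<in> set xs") (auto simp: permutes_not_in)
    then have "\<rho> = \<pi>" by blast
    with that show ?thesis by simp
  qed
  then have "(\<exists>\<rho>. \<rho> permutes set xs \<and> evenperm \<rho> \<and> map \<pi> xs = map \<rho> xs) \<longleftrightarrow> evenperm \<pi>"
    using assms by blast
  then show ?thesis
    unfolding list_sign_def sign_def by simp
qed

lemma ex_permutes_map:
  assumes "distinct xs" "distinct ys" "set xs = set ys"
  shows "\<exists>\<pi>. \<pi> permutes set xs \<and> ys = map \<pi> xs"
proof -
  have len: "length xs = length ys"
    using assms by (metis distinct_card)
  define \<pi> where "\<pi> = permutation_of_list (zip xs ys)"
  have "list_permutes (zip xs ys) (set xs)"
    using assms len by (auto simp: list_permutes_def)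
  then have p: "\<pi> permutes set xs"
    unfolding \<pi>_def by (rule permutation_of_list_permutes)
  have "ys ! k = \<pi> (xs ! k)" if "k < length xs" for k
    using that assms len
    by (auto simp: \<pi>_def permutation_of_list_def map_of_zip_nth)
  then have "ys = map \<pi> xs"
    using len by (auto intro: nth_equalityI)
  with p show ?thesis by blast
qed

text \<open>The rearranging permutations compose and \<open>sign\<close> is multiplicative. Chains
  of this rule carry the later sign computations.\<close>

lemma list_sign_trans:
  assumes "distinct xs" "distinct ys" "distinct zs" "set xs = set ys" "set ys = set zs"
  shows "list_sign xs zs = list_sign xs ys * list_sign ys zs"
proof -
  obtain \<pi> where p: "\<pi> permutes set xs" "ys = map \<pi> xs"
    using ex_permutes_map[OF assms(1,2,4)] by blast
  obtain \<rho> where r: "\<rho> permutes set ys" "zs = map \<rho> ys"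
    using ex_permutes_map[OF assms(2,3,5)] by blast
  have r': "\<rho> permutes set xs" using r(1) assms(4) by simp
  have "sign (\<rho> \<circ> \<pi>) = sign \<rho> * sign \<pi>"
    using p(1) r' by (intro sign_compose permutes_imp_permutation[of "set xs"]) auto
  moreover have "list_sign xs zs = sign (\<rho> \<circ> \<pi>)"
    unfolding r(2) p(2) using list_sign_map[OF permutes_compose[OF p(1) r']] by simp
  ultimately show ?thesis
    using list_sign_map[OF p(1), folded p(2)] list_sign_map[OF r(1), folded r(2)] by simp
qed

lemma list_sign_refl [simp]: "list_sign xs xs = 1"
  using list_sign_map[OF permutes_id, of xs] by simp

lemma list_sign_commute:
  assumes "distinct xs" "distinct ys" "set xs = set ys"
  shows "list_sign ys xs = list_sign xs ys"
proof -
  have "list_sign xs xs = list_sign xs ys * list_sign ys xs"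
    by (rule list_sign_trans) (simp_all only: assms)
  then show ?thesis
    using list_sign_cases[of xs ys] list_sign_cases[of ys xs] by auto
qed

lemma list_sign_Cons:
  assumes "distinct (v # xs)" "distinct (v # ys)" "set xs = set ys"
  shows "list_sign (v # xs) (v # ys) = list_sign xs ys"
proof -
  obtain \<pi> where p: "\<pi> permutes set xs" "ys = map \<pi> xs"
    using ex_permutes_map[of xs ys] assms by (metis distinct.simps(2))
  have "\<pi> permutes set (v # xs)"
    using p(1) by (rule permutes_subset) auto
  moreover have "\<pi> v = v" using permutes_not_in[OF p(1), of v] assms(1) by simp
  ultimately show ?thesis
    using list_sign_map[of \<pi> "v # xs"] list_sign_map[OF p(1)] p(2) by simp
qed

lemma list_sign_swap:
  assumes "distinct (xs @ a # b # ys)"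
  shows "list_sign (xs @ a # b # ys) (xs @ b # a # ys) = - 1"
proof -
  let ?t = "transpose a b"
  have "?t permutes set (xs @ a # b # ys)"
    by (rule permutes_swap_id) auto
  moreover have "map ?t (xs @ a # b # ys) = xs @ b # a # ys"
    using assms by (auto simp: transpose_def intro!: map_idI)
  moreover have "sign ?t = - 1" using assms by (simp add: sign_swap_id)
  ultimately show ?thesis using list_sign_map[of ?t "xs @ a # b # ys"] by simp
qed

text \<open>Induction from the back of \<open>xs\<close>: one adjacent swap carries \<open>v\<close>
  past the last entry \<open>x\<close>, and the induction hypothesis, with \<open>x\<close> now at
  the head of the remaining list, carries it past the rest.\<close>

lemma list_sign_move_front:
  assumes "distinct (xs @ v # ys)"
  shows "list_sign (xs @ v # ys) (v # xs @ ys) = (- 1) ^ length xs"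
  using assms
proof (induction xs arbitrary: ys rule: rev_induct)
  case (snoc x xs)
  have "list_sign (xs @ x # v # ys) (v # xs @ x # ys) =
      list_sign (xs @ x # v # ys) (xs @ v # x # ys) * list_sign (xs @ v # x # ys) (v # xs @ x # ys)"
    using snoc.prems by (intro list_sign_trans) auto
  also have "\<dots> = - ((- 1) ^ length xs)"
    using snoc.prems snoc.IH[of "x # ys"] list_sign_swap[of xs x v ys] by auto
  finally show ?case by simp
qed simp

section \<open>Orientations as equivalence classes of orderings\<close>

lemma even_perm_rel_iff:
  "(xs, ys) \<in> even_perm_rel F \<longleftrightarrow>
     xs \<in> permutations_of_set F \<and> ys \<in> permutations_of_set F \<and> list_sign xs ys = 1"
  by (auto simp: even_perm_rel_def list_sign_def permutations_of_set_def)

lemma equiv_even_perm_rel: "equiv (permutations_of_set F) (even_perm_rel F)"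
proof (rule equivI)
  show "even_perm_rel F \<subseteq> permutations_of_set F \<times> permutations_of_set F"
    by (auto simp: even_perm_rel_iff)
  show "refl_on (permutations_of_set F) (even_perm_rel F)"
    by (auto simp: refl_on_def even_perm_rel_iff)
  show "sym (even_perm_rel F)"
    by (auto simp: sym_def even_perm_rel_iff permutations_of_set_def list_sign_commute)
  show "trans (even_perm_rel F)"
  proof (rule transI)
    fix xs ys zs
    assume "(xs, ys) \<in> even_perm_rel F" "(ys, zs) \<in> even_perm_rel F"
    then show "(xs, zs) \<in> even_perm_rel F"
      using list_sign_trans[of xs ys zs]
      by (auto simp: even_perm_rel_iff permutations_of_set_def)
  qed
qed

lemma face_orientation_mem_iff:
  assumes "C \<in> face_orientations F" "xs \<in> C"
  shows "ys \<in> C \<longleftrightarrow> ys \<in> permutations_of_set F \<and> list_sign xs ys = 1"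
proof -
  obtain zs where "C = even_perm_rel F `` {zs}"
    using assms(1) unfolding face_orientations_def by (rule quotientE)
  moreover from this have "even_perm_rel F `` {zs} = even_perm_rel F `` {xs}"
    using assms(2) by (intro equiv_class_eq[OF equiv_even_perm_rel]) simp
  ultimately show ?thesis using assms(2) by (auto simp: even_perm_rel_iff)
qed

lemma face_orientation_subset:
  assumes "C \<in> face_orientations F" "xs \<in> C"
  shows "distinct xs" "set xs = F"
  using assms in_quotient_imp_subset[OF equiv_even_perm_rel, of C F]
  by (auto simp: face_orientations_def permutations_of_set_def)

lemma face_orientation_nonempty:
  assumes "C \<in> face_orientations F"
  obtains xs where "xs \<in> C"
  using assms in_quotient_imp_non_empty[OF equiv_even_perm_rel, of C F]
  by (auto simp: face_orientations_def)

section \<open>Incidence signs and orientability\<close>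

text \<open>Both branches are a power of \<open>- 1\<close> up to sign, whatever index
  \<open>THE\<close> returns.\<close>

lemma incidence_sign_cases: "incidence_sign \<omega> F G = 1 \<or> incidence_sign \<omega> F G = - 1"
  by (auto simp: incidence_sign_def Let_def minus_one_power_iff)

lemma incidence_sign_square [simp]: "incidence_sign \<omega> F G * incidence_sign \<omega> F G = 1"
  using incidence_sign_cases[of \<omega> F G] by auto

text \<open>Moving \<open>v\<close> to the front of \<open>vs\<close> costs the sign \<open>(- 1) ^ j\<close> of the definition.\<close>

lemma incidence_sign_eq:
  assumes E: "\<omega> E \<in> face_orientations E" and G: "\<omega> G \<in> face_orientations G"
    and vs: "vs \<in> \<omega> G" and es: "es \<in> \<omega> E"
    and v: "v \<notin> E" "G = insert v E"
  shows "incidence_sign \<omega> E G = list_sign vs (v # es)"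
proof -
  \<comment> \<open>The representative that \<open>incidence_sign\<close> itself picks; it may
    differ from \<open>vs\<close>.\<close>
  define ws where "ws = (SOME ws. ws \<in> \<omega> G)"
  have ws: "ws \<in> \<omega> G" unfolding ws_def using vs by (rule someI)
  note dw = face_orientation_subset[OF G ws] and dv = face_orientation_subset[OF G vs]
    and de = face_orientation_subset[OF E es]
  obtain as bs where ab: "ws = as @ v # bs"
    using dw v by (metis insertI1 split_list)
  have setE: "set (as @ bs) = E" using ab dw v by auto
  have j: "(THE j. j < length ws \<and> E = G - {ws ! j}) = length as"
  proof (rule the_equality)
    show "length as < length ws \<and> E = G - {ws ! length as}"
      using ab v by auto
  next
    fix j assume j: "j < length ws \<and> E = G - {ws ! j}"
    then have "ws ! j = v" using v dw by (metis Diff_iff insertCI nth_mem singletonD)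
    moreover have "ws ! length as = v" "length as < length ws" using ab by auto
    ultimately show "j = length as" using dw j by (metis nth_eq_iff_index_eq)
  qed
  have del: "take (length as) ws @ drop (Suc (length as)) ws = as @ bs"
    using ab by simp
  have dab: "distinct (as @ bs)" using dw ab by auto
  have mem: "as @ bs \<in> \<omega> E \<longleftrightarrow> list_sign es (as @ bs) = 1"
    using face_orientation_mem_iff[OF E es] setE dab by (auto simp: permutations_of_set_def)
  \<comment> \<open>Position of \<open>v\<close> and membership test give one factor each. Both are
    rewritten as signs of rearrangements and chained from \<open>ws\<close> to
    \<open>v # es\<close>; replacing \<open>ws\<close> by \<open>vs\<close> is then free, as both
    lie in \<open>\<omega> G\<close>.\<close>
  have "incidence_sign \<omega> E G = (- 1) ^ length as * list_sign es (as @ bs)"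
    unfolding incidence_sign_def ws_def[symmetric] Let_def j del mem
    using list_sign_cases[of es "as @ bs"] by auto
  also have "list_sign es (as @ bs) = list_sign (as @ bs) es"
    using dab de setE by (intro list_sign_commute) auto
  also have "\<dots> = list_sign (v # as @ bs) (v # es)"
    using dab de setE v by (intro list_sign_Cons[symmetric]) auto
  also have "(- 1) ^ length as = list_sign ws (v # as @ bs)"
    using list_sign_move_front[of as v bs] dw ab by simp
  also have "list_sign ws (v # as @ bs) * list_sign (v # as @ bs) (v # es) = list_sign ws (v # es)"
    using dab dw de setE v by (intro list_sign_trans[symmetric]) auto
  also have "\<dots> = list_sign ws vs * list_sign vs (v # es)"
    using dv dw de v by (intro list_sign_trans) auto
  also have "list_sign ws vs = 1"
    using face_orientation_mem_iff[OF G ws] vs by auto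
  finally show ?thesis by simp
qed

text \<open>By \<open>incidence_sign_eq\<close> the new sign compares \<open>vs'\<close> with
  \<open>v # es'\<close>; the detour through \<open>vs\<close> and \<open>v # es\<close> splits off
  one factor for each change of orientation.\<close>

lemma incidence_sign_change:
  assumes E: "\<omega> E \<in> face_orientations E" "\<omega>' E \<in> face_orientations E"
    and G: "\<omega> G \<in> face_orientations G" "\<omega>' G \<in> face_orientations G"
    and vs: "vs \<in> \<omega> G" "vs' \<in> \<omega>' G" and es: "es \<in> \<omega> E" "es' \<in> \<omega>' E"
    and EG: "E \<subset> G" "card G = Suc (card E)"
  shows "incidence_sign \<omega>' E G = list_sign vs vs' * list_sign es es' * incidence_sign \<omega> E G"
proof -
  note dv = face_orientation_subset[OF G(1) vs(1)] and dv' = face_orientation_subset[OF G(2) vs(2)]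
  note de = face_orientation_subset[OF E(1) es(1)] and de' = face_orientation_subset[OF E(2) es(2)]
  have "finite G" using EG(2) by (metis Suc_neq_Zero card.infinite)
  then have "card (G - E) = 1"
    using EG by (subst card_Diff_subset) (auto intro: finite_subset)
  then obtain v where "G - E = {v}" by (rule card_1_singletonE)
  then have v: "v \<notin> E" "G = insert v E" using EG by auto
  have "incidence_sign \<omega>' E G = list_sign vs' (v # es')"
    using E(2) G(2) vs(2) es(2) v by (rule incidence_sign_eq)
  also have "\<dots> = list_sign vs' vs * list_sign vs (v # es')"
    using dv dv' de' v by (intro list_sign_trans) auto
  also have "list_sign vs (v # es') = list_sign vs (v # es) * list_sign (v # es) (v # es')"
    using dv de de' v by (intro list_sign_trans) auto
  also have "list_sign (v # es) (v # es') = list_sign es es'"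
    using de de' v by (intro list_sign_Cons) auto
  also have "list_sign vs (v # es) = incidence_sign \<omega> E G"
    using incidence_sign_eq[OF E(1) G(1) vs(1) es(1) v] by simp
  also have "list_sign vs' vs = list_sign vs vs'"
    using dv dv' by (intro list_sign_commute) auto
  finally show ?thesis by simp
qed

section \<open>Orientability as a sign condition on top faces\<close>

lemma generated_faces:
  assumes "\<F> \<subseteq> faces d K" "\<And>F. F \<in> \<F> \<Longrightarrow> finite F"
  shows "faces d (generated_complex \<F>) = \<F>"
proof
  show "faces d (generated_complex \<F>) \<subseteq> \<F>"
  proof
    fix G assume "G \<in> faces d (generated_complex \<F>)"
    then obtain F where "F \<in> \<F>" "G \<subseteq> F" "card G = d + 1"
      by (auto simp: faces_def generated_complex_def)
    moreover from this have "card F = d + 1" using assms by (auto simp: faces_def)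
    ultimately show "G \<in> \<F>" using assms(2) by (metis card_subset_eq)
  qed
  show "\<F> \<subseteq> faces d (generated_complex \<F>)"
    using assms(1) by (auto simp: faces_def generated_complex_def)
qed

text \<open>Relative to the fixed \<open>\<omega>\<close>, another orientation amounts to a sign on
  each face. The sign of the common face \<open>F \<inter> G\<close> multiplies both incidence signs
  and cancels, so only the signs \<open>t\<close> of the top faces remain.\<close>

lemma orientable_generated_iff:
  assumes K: "simplicial_complex K" and \<omega>: "orientation K \<omega>" and \<F>: "\<F> \<subseteq> faces (i + 1) K"
  shows "orientable i (generated_complex \<F>) \<longleftrightarrow>
    (\<exists>t. (\<forall>F. t F = 1 \<or> t F = (- 1 :: int)) \<and>
       (\<forall>F\<in>\<F>. \<forall>G\<in>\<F>. F \<inter> G \<in> faces i K \<longrightarrow>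
          t F * incidence_sign \<omega> (F \<inter> G) F = - (t G * incidence_sign \<omega> (F \<inter> G) G)))"
    (is "?L \<longleftrightarrow> ?R")
proof -
  let ?C = "generated_complex \<F>"
  have fin: "finite F" if "F \<in> \<F>" for F
    using that \<F> by (metis (mono_tags, lifting) Suc_eq_plus1 card.infinite faces_def mem_Collect_eq
        nat.distinct(1) subset_eq)
  have facesC: "faces (i + 1) ?C = \<F>" using \<F> fin by (rule generated_faces)
  have CK: "?C \<subseteq> K"
    using \<F> K by (auto simp: generated_complex_def faces_def simplicial_complex_def)
  have int_faces: "F \<inter> G \<in> faces i ?C \<longleftrightarrow> F \<inter> G \<in> faces i K" if "F \<in> \<F>" "G \<in> \<F>" for F G
    using that CK by (auto simp: faces_def generated_complex_def)
  have inC: "F \<inter> G \<in> ?C" "F \<in> ?C" if "F \<in> \<F>" for F G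
    using that by (auto simp: generated_complex_def)
  have sub: "F \<inter> G \<subset> F" "card F = Suc (card (F \<inter> G))" if "F \<in> \<F>" "F \<inter> G \<in> faces i K" for F G
  proof -
    show "card F = Suc (card (F \<inter> G))" using that \<F> by (auto simp: faces_def)
    then show "F \<inter> G \<subset> F" by (metis inf.cobounded1 n_not_Suc_n psubsetI)
  qed
  have orK: "\<omega> F \<in> face_orientations F" if "F \<in> ?C" for F
    using that CK \<omega> by (auto simp: orientation_def)
  define r where "r F = (SOME xs. xs \<in> \<omega> F)" for F
  have r: "r F \<in> \<omega> F" if "F \<in> ?C" for F
    unfolding r_def using orK[OF that] by (metis face_orientation_nonempty someI_ex)
  show ?thesis
  proof
    assume ?L
    then obtain \<omega>' where o: "orientation ?C \<omega>'"
      and opp: "\<And>F G. F \<in> \<F> \<Longrightarrow> G \<in> \<F> \<Longrightarrow> F \<inter> G \<in> faces i K \<Longrightarrow>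
           incidence_sign \<omega>' (F \<inter> G) F = - incidence_sign \<omega>' (F \<inter> G) G"
      unfolding orientable_def facesC by (metis int_faces)
    have orC: "\<omega>' F \<in> face_orientations F" if "F \<in> ?C" for F
      using that o by (auto simp: orientation_def)
    define r' where "r' F = (SOME xs. xs \<in> \<omega>' F)" for F
    have r': "r' F \<in> \<omega>' F" if "F \<in> ?C" for F
      unfolding r'_def using orC[OF that] by (metis face_orientation_nonempty someI_ex)
    \<comment> \<open>\<open>t F = - 1\<close> records that \<open>\<omega>'\<close> reverses
      \<open>\<omega>\<close> on \<open>F\<close>.\<close>
    define t where "t F = list_sign (r F) (r' F)" for F
    have t: "t F = 1 \<or> t F = - 1" for F by (simp add: t_def list_sign_cases)
    have change: "incidence_sign \<omega>' (F \<inter> G) F = t F * t (F \<inter> G) * incidence_sign \<omega> (F \<inter> G) F"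
      if "F \<in> \<F>" "F \<inter> G \<in> faces i K" for F G
      unfolding t_def using sub[OF that] inC[OF that(1)] orK orC r r'
      by (intro incidence_sign_change) auto
    have "t F * incidence_sign \<omega> (F \<inter> G) F = - (t G * incidence_sign \<omega> (F \<inter> G) G)"
      if "F \<in> \<F>" "G \<in> \<F>" "F \<inter> G \<in> faces i K" for F G
      using opp[OF that] change[OF that(1,3)] change[of G F] that t[of "F \<inter> G"]
      by (auto simp: Int_commute)
    with t show ?R by blast
  next
    assume ?R
    then obtain t where t: "\<And>F. t F = 1 \<or> t F = (- 1 :: int)"
      and opp: "\<And>F G. F \<in> \<F> \<Longrightarrow> G \<in> \<F> \<Longrightarrow> F \<inter> G \<in> faces i K \<Longrightarrow>
          t F * incidence_sign \<omega> (F \<inter> G) F = - (t G * incidence_sign \<omega> (F \<inter> G) G)"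
      by blast
    \<comment> \<open>Faces outside \<open>\<F>\<close> keep their class; a vertex, having a single
      ordering, could not be reversed.\<close>
    have "\<exists>ys. distinct ys \<and> set ys = F \<and> list_sign (r F) ys = (if F \<in> \<F> then t F else 1)"
      if "F \<in> ?C" for F
    proof (cases "F \<in> \<F> \<and> t F = - 1")
      case True
      note d = face_orientation_subset[OF orK[OF that] r[OF that]]
      \<comment> \<open>A top face has at least two vertices, so swapping the first two gives the
        opposite class.\<close>
      have "length (r F) = i + 2"
        using True \<F> d distinct_card[of "r F"] by (auto simp: faces_def)
      then obtain a b ys where ab: "r F = a # b # ys"
        by (metis Suc_length_conv add_2_eq_Suc')
      then show ?thesis
        using True d list_sign_swap[of "[]" a b ys] by (intro exI[of _ "b # a # ys"]) auto
    next
      case False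
      then show ?thesis
        using face_orientation_subset[OF orK[OF that] r[OF that]] t
        by (intro exI[of _ "r F"]) auto
    qed
    then obtain w where w: "\<And>F. F \<in> ?C \<Longrightarrow> distinct (w F) \<and> set (w F) = F"
      "\<And>F. F \<in> ?C \<Longrightarrow> list_sign (r F) (w F) = (if F \<in> \<F> then t F else 1)"
      by metis
    define \<omega>' where "\<omega>' F = even_perm_rel F `` {w F}" for F
    have wp: "w F \<in> permutations_of_set F" if "F \<in> ?C" for F
      using w(1)[OF that] by (auto simp: permutations_of_set_def)
    have orC: "\<omega>' F \<in> face_orientations F" if "F \<in> ?C" for F
      unfolding \<omega>'_def face_orientations_def using wp[OF that] by (rule quotientI)
    have wm: "w F \<in> \<omega>' F" if "F \<in> ?C" for F
      unfolding \<omega>'_def using wp[OF that] equiv_even_perm_rel by (metis equiv_class_self)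
    have change: "incidence_sign \<omega>' (F \<inter> G) F =
        t F * list_sign (r (F \<inter> G)) (w (F \<inter> G)) * incidence_sign \<omega> (F \<inter> G) F"
      if "F \<in> \<F>" "F \<inter> G \<in> faces i K" for F G
    proof -
      have "t F = list_sign (r F) (w F)" using w(2)[OF inC(2)] that by simp
      then show ?thesis
        using sub[OF that] inC[OF that(1)] orK orC r wm
        by (simp only:) (intro incidence_sign_change, auto)
    qed
    have "incidence_sign \<omega>' (F \<inter> G) F = - incidence_sign \<omega>' (F \<inter> G) G"
      if "F \<in> \<F>" "G \<in> \<F>" "F \<inter> G \<in> faces i K" for F G
      using opp[OF that] change[OF that(1,3)] change[of G F] that
        list_sign_cases[of "r (F \<inter> G)" "w (F \<inter> G)"]
      by (auto simp: Int_commute)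
    then show ?L
      unfolding orientable_def facesC orientation_def using orC int_faces by (intro exI[of _ \<omega>']) simp
  qed
qed

section \<open>Walks in signed relations\<close>

text \<open>Loops and pairs related by both signs are allowed. The locale is interpreted twice: by
  the edges of the incidence graph, and by top faces containing a common i-face.\<close>

locale signed_relation =
  fixes R :: "'v \<Rightarrow> 'v \<Rightarrow> int \<Rightarrow> bool"
  assumes sym: "R x y s \<Longrightarrow> R y x s"
    and sgn: "R x y s \<Longrightarrow> s = 1 \<or> s = - 1"
begin

inductive walk :: "'v \<Rightarrow> 'v \<Rightarrow> nat \<Rightarrow> int \<Rightarrow> bool" where
  walk_Nil: "walk x x 0 1"
| walk_Cons: "R x y s \<Longrightarrow> walk y z n t \<Longrightarrow> walk x z (Suc n) (s * t)"

lemma walk_step: "R x y s \<Longrightarrow> walk x y 1 s"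
  using walk_Cons[OF _ walk_Nil] by fastforce

lemma walk_append: "walk x y m s \<Longrightarrow> walk y z n t \<Longrightarrow> walk x z (m + n) (s * t)"
proof (induction rule: walk.induct)
  case (walk_Cons x y s w m u)
  then show ?case using walk.walk_Cons[of x y s z "m + n" "u * t"] by (simp add: mult.assoc)
qed simp

lemma walk_rev: "walk x y n s \<Longrightarrow> walk y x n s"
proof (induction rule: walk.induct)
  case (walk_Cons x y s z n t)
  then show ?case using walk_append[OF _ walk_step[OF sym]] by (fastforce simp: mult.commute)
qed (rule walk_Nil)

lemma walk_sign: "walk x y n s \<Longrightarrow> s = 1 \<or> s = - 1"
proof (induction rule: walk.induct)
  case (walk_Cons x y s z n t)
  then show ?case using sgn by fastforce
qed simp

text \<open>\<open>walk\<close> records only ends, length and sign; the enumeration of vertices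
  \<open>f\<close> and step signs \<open>e\<close> makes it possible to cut a walk at given
  positions.\<close>

lemma walk_function:
  assumes "walk x y n s"
  shows "\<exists>f e. f 0 = x \<and> f n = y \<and> (\<forall>k<n. R (f k) (f (Suc k)) (e k)) \<and> (\<Prod>k<n. e k) = s"
  using assms
proof (induction rule: walk.induct)
  case (walk_Nil x)
  then show ?case by (intro exI[of _ "\<lambda>_. x"]) simp
next
  case (walk_Cons x y s z n t)
  then obtain f e where fe: "f 0 = y" "f n = z" "\<And>k. k < n \<Longrightarrow> R (f k) (f (Suc k)) (e k)"
    "(\<Prod>k<n. e k) = t"
    by blast
  define f' where "f' = case_nat x f"
  define e' where "e' = case_nat s e"
  have "R (f' k) (f' (Suc k)) (e' k)" if "k < Suc n" for k
    using that fe walk_Cons.hyps(1) by (cases k) (auto simp: f'_def e'_def)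
  moreover have "(\<Prod>k<Suc n. e' k) = s * t"
    using fe(4) by (simp add: e'_def prod.lessThan_Suc_shift del: prod.lessThan_Suc)
  moreover have "f' 0 = x" "f' (Suc n) = z" using fe by (auto simp: f'_def)
  ultimately show ?case by blast
qed

lemma walk_segment:
  assumes "\<And>k. k < n \<Longrightarrow> R (f k) (f (Suc k)) (e k)" "j + m \<le> n"
  shows "walk (f j) (f (j + m)) m (\<Prod>k=j..<j+m. e k)"
  using assms(2)
proof (induction m)
  case (Suc m)
  have "R (f (j + m)) (f (Suc (j + m))) (e (j + m))"
    using assms(1) Suc.prems by simp
  moreover have "walk (f j) (f (j + m)) m (\<Prod>k=j..<j+m. e k)"
    using Suc by simp
  ultimately have "walk (f j) (f (Suc (j + m))) (m + 1) ((\<Prod>k=j..<j+m. e k) * e (j + m))"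
    by (meson walk_append walk_step)
  then show ?case by simp
qed (simp add: walk_Nil)

text \<open>Two walks with the same ends have equal signs, since one followed by the reverse of the
  other is closed. So the sign of a walk from a root depends on its end only, and one more step
  multiplies it by \<open>s\<close>.\<close>

lemma ex_potential:
  assumes "\<And>x n. \<not> walk x x n (- 1)"
  shows "\<exists>p :: 'v \<Rightarrow> int. (\<forall>x. p x = 1 \<or> p x = - 1) \<and> (\<forall>x y s. R x y s \<longrightarrow> s = p x * p y)"
proof -
  have uniq: "s = t" if "walk x y m s" "walk x y n t" for x y m n s t
  proof (rule ccontr)
    assume "s \<noteq> t"
    with walk_sign[OF that(1)] walk_sign[OF that(2)] have "s * t = - 1" by auto
    with walk_append[OF that(1) walk_rev[OF that(2)]] assms show False by simp
  qed
  define root where "root y = (SOME x. \<exists>n s. walk x y n s)" for y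
  have root: "\<exists>n s. walk (root y) y n s" for y
    unfolding root_def by (rule someI_ex) (meson walk_Nil)
  define p where "p y = (SOME s. \<exists>n. walk (root y) y n s)" for y
  have p: "\<exists>n. walk (root y) y n (p y)" for y
    unfolding p_def by (rule someI_ex) (meson root)
  have p_sign: "p x = 1 \<or> p x = - 1" for x
    using p[of x] by (auto dest: walk_sign)
  have "s = p x * p y" if R: "R x y s" for x y s
  proof -
    \<comment> \<open>Neighbours are reached from the same points, so \<open>SOME\<close> picks the
      same root for both.\<close>
    have "(\<exists>n s. walk z x n s) \<longleftrightarrow> (\<exists>n s. walk z y n s)" for z
      by (meson R sym walk_append walk_step)
    then have "root x = root y" by (simp add: root_def)
    moreover obtain m where "walk (root x) x m (p x)" using p by blast
    moreover obtain n where "walk (root y) y n (p y)" using p by blast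
    ultimately have "walk (root y) y (m + 1) (p x * s)" "walk (root y) y n (p y)"
      using walk_append[OF _ walk_step[OF R]] by simp_all
    then have "p y = p x * s" by (rule uniq[symmetric])
    then show ?thesis using p_sign[of x] by auto
  qed
  with p_sign show ?thesis by blast
qed

text \<open>A repeated vertex or a chord cuts the closed walk into two shorter ones whose signs
  multiply to \<open>- 1\<close>. One of them is negative, against minimality.\<close>

lemma shortest_negative_closed_walk:
  assumes "walk x x n (- 1)"
  obtains f e n where "0 < n" "f n = f 0" "\<And>k. k < n \<Longrightarrow> R (f k) (f (Suc k)) (e k)"
    "(\<Prod>k<n. e k) = - 1" "inj_on f {..<n}"
    "\<And>j l t. j < l \<Longrightarrow> l < n \<Longrightarrow> R (f j) (f l) t \<Longrightarrow> l = Suc j \<or> j = 0 \<and> Suc l = n"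
proof -
  define N where "N = (LEAST n. \<exists>x. walk x x n (- 1))"
  have "\<exists>x. walk x x N (- 1)" unfolding N_def
    by (rule LeastI_ex[of "\<lambda>n. \<exists>x. walk x x n (- 1)"]) (use assms in blast)
  then obtain x\<^sub>0 where "walk x\<^sub>0 x\<^sub>0 N (- 1)" by blast
  from walk_function[OF this] obtain f e where "f 0 = x\<^sub>0" "f N = x\<^sub>0"
    and R': "\<forall>k<N. R (f k) (f (Suc k)) (e k)" and e: "(\<Prod>k<N. e k) = - 1"
    by blast
  then have f: "f N = f 0" by simp
  have R: "R (f k) (f (Suc k)) (e k)" if "k < N" for k using R' that by blast
  have least: False if "walk y y m s" "walk z z m' s'" "m < N" "m' < N" "s * s' = - 1" for y z m m' s s'
  proof -
    have "s = - 1 \<or> s' = - 1"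
      using that walk_sign[OF that(1)] walk_sign[OF that(2)] by auto
    moreover have "\<not> walk x x k (- 1)" if "k < N" for x k
      using not_less_Least[OF that[unfolded N_def]] by blast
    ultimately show False using that by auto
  qed
  have "N > 0" using e by (cases N) auto
  let ?P = "\<lambda>a b. \<Prod>k=a..<b. e k"
  have seg: "walk (f a) (f b) (b - a) (?P a b)" if "a \<le> b" "b \<le> N" for a b
    using walk_segment[of N f e a "b - a", OF R] that by simp
  have prod: "?P 0 j * ?P j l * ?P l N = - 1" if "j < l" "l < N" for j l
    using that e prod.atLeastLessThan_concat[of 0 j l e] prod.atLeastLessThan_concat[of 0 l N e]
    by (simp add: lessThan_atLeast0)
  have ne: "f j \<noteq> f l" if "j < l" "l < N" for j l
  proof
    assume eq: "f j = f l"
    have "walk (f j) (f j) (l - j) (?P j l)" using seg[of j l] that eq by simp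
    \<comment> \<open>The walk with the segment from \<open>j\<close> to \<open>l\<close> cut
      out.\<close>
    moreover have "walk (f 0) (f 0) (j - 0 + (N - l)) (?P 0 j * ?P l N)"
    proof (rule walk_append)
      show "walk (f 0) (f j) (j - 0) (?P 0 j)" using seg[of 0 j] that by simp
      show "walk (f j) (f 0) (N - l) (?P l N)" using seg[of l N] that eq f by simp
    qed
    ultimately show False
    proof (rule least)
      show "?P j l * (?P 0 j * ?P l N) = - 1" using prod[OF that] by (simp only: mult_ac)
    qed (use that in auto)
  qed
  have inj: "inj_on f {..<N}" by (rule linorder_inj_onI) (use ne in auto)
  have chord: "l = Suc j \<or> j = 0 \<and> Suc l = N" if "j < l" "l < N" "R (f j) (f l) t" for j l t
  proof (rule ccontr)
    assume nonadj: "\<not> ?thesis"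
    \<comment> \<open>The chord closes up the segment from \<open>j\<close> to \<open>l\<close> and
      bridges the gap in the rest. The first walk is shorter than \<open>N\<close> unless
      \<open>j = 0\<close> and \<open>Suc l = N\<close>, the second unless
      \<open>l = Suc j\<close>.\<close>
    have "walk (f j) (f j) (l - j + 1) (?P j l * t)"
      using that by (intro walk_append[OF seg walk_step[OF sym]]) auto
    moreover have "walk (f 0) (f 0) (j - 0 + 1 + (N - l)) (?P 0 j * t * ?P l N)"
    proof (rule walk_append[OF walk_append[OF _ walk_step[OF that(3)]]])
      show "walk (f 0) (f j) (j - 0) (?P 0 j)" using seg[of 0 j] that by simp
      show "walk (f l) (f 0) (N - l) (?P l N)" using seg[of l N] that f by simp
    qed
    ultimately show False
    proof (rule least)
      \<comment> \<open>Both pieces use the chord, so its sign cancels.\<close>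
      have "t * t = 1" using sgn[OF that(3)] by auto
      moreover have "?P j l * t * (?P 0 j * t * ?P l N) = t * t * (?P 0 j * ?P j l * ?P l N)"
        by (simp only: mult_ac)
      ultimately show "?P j l * t * (?P 0 j * t * ?P l N) = - 1"
        using prod[OF that(1,2)] by simp
    qed (use nonadj that in auto)
  qed
  show thesis
    by (rule that[of N f e]) (use \<open>N > 0\<close> f R e inj chord in blast)+
qed

end

section \<open>Closed walks as cyclic lists\<close>

lemma prod_Suc_mod:
  fixes g :: "nat \<Rightarrow> 'b :: comm_monoid_mult"
  shows "(\<Prod>k<n. g (Suc k mod n)) = (\<Prod>k<n. g k)"
proof (cases n)
  case (Suc m)
  \<comment> \<open>Only the last index wraps round to 0; its factor is split off.\<close>
  have "(\<Prod>k<n. g (Suc k mod n)) = (\<Prod>k<m. g (Suc k mod Suc m)) * g 0"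
    by (simp add: Suc)
  also have "(\<Prod>k<m. g (Suc k mod Suc m)) = (\<Prod>k<m. g (Suc k))"
    by (rule prod.cong) auto
  also have "(\<Prod>k<m. g (Suc k)) * g 0 = (\<Prod>k<n. g k)"
    by (simp add: Suc prod.lessThan_Suc_shift mult.commute del: prod.lessThan_Suc)
  finally show ?thesis .
qed simp

text \<open>Links closed walks, where position \<open>n\<close> repeats position 0, with lists of
  vertices that omit the repetition.\<close>

lemma nth_map_closed:
  assumes "k < n" "f n = f 0"
  shows "map f [0..<n] ! (Suc k mod n) = f (Suc k)"
proof (cases "Suc k = n")
  case False
  with assms show ?thesis by simp
qed (use assms in auto)

section \<open>Balance and circuits\<close>

text \<open>A switching function that makes every edge of the incidence graph positive.\<close>

definition incidence_potential ::
    "nat \<Rightarrow> 'a set set \<Rightarrow> ('a set \<Rightarrow> 'a list set) \<Rightarrow> ('a set \<Rightarrow> int) \<Rightarrow> bool" where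
  "incidence_potential i K \<omega> p \<longleftrightarrow> (\<forall>F. p F = 1 \<or> p F = - 1) \<and>
     (\<forall>E\<in>faces i K. \<forall>F\<in>faces (i + 1) K. E \<subset> F \<longrightarrow> incidence_sign \<omega> E F = p E * p F)"

lemma edge_sign_incidence:
  assumes "E \<subset> F"
  shows "edge_sign (signed_incidence_graph i K \<omega>) {E, F} = incidence_sign \<omega> E F"
proof -
  have "\<Inter>{E, F} = E" "\<Union>{E, F} = F" using assms by auto
  then show ?thesis by (simp add: signed_incidence_graph_def)
qed

lemma edges_signed_incidence_graph:
  "e \<in> edges (signed_incidence_graph i K \<omega>) \<longleftrightarrow>
     (\<exists>E F. e = {E, F} \<and> E \<in> faces i K \<and> F \<in> faces (i + 1) K \<and> E \<subset> F)"
  by (simp add: signed_incidence_graph_def)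

text \<open>Each vertex of a cycle lies on two of its edges, so its \<open>p\<close> enters the
  product squared.\<close>

lemma balanced_if_potential:
  assumes "incidence_potential i K \<omega> p"
  shows "balanced (signed_incidence_graph i K \<omega>)"
  unfolding balanced_def
proof (intro allI impI)
  let ?\<Gamma> = "signed_incidence_graph i K \<omega>"
  fix c assume c: "is_cycle ?\<Gamma> c"
  let ?n = "length c"
  have p: "p F * p F = 1" for F
  proof -
    have "p F = 1 \<or> p F = - 1" using assms by (simp add: incidence_potential_def)
    then show ?thesis by auto
  qed
  have edge: "edge_sign ?\<Gamma> {x, y} = p x * p y" if xy: "{x, y} \<in> edges ?\<Gamma>" for x y
  proof -
    obtain E F where EF: "{x, y} = {E, F}" "E \<in> faces i K" "F \<in> faces (i + 1) K" "E \<subset> F"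
      using xy unfolding edges_signed_incidence_graph by (elim exE conjE) (rule that)
    have "edge_sign ?\<Gamma> {E, F} = p E * p F"
      using EF(2-4) assms by (simp add: edge_sign_incidence incidence_potential_def)
    \<comment> \<open>Which of \<open>x\<close> and \<open>y\<close> is the smaller face is unknown,
      but the product is symmetric.\<close>
    moreover have "p x * p y = p E * p F"
      using EF(1) by (auto simp: doubleton_eq_iff)
    ultimately show ?thesis using EF(1) by simp
  qed
  have "cycle_sign ?\<Gamma> c = (\<Prod>k<?n. p (c ! k) * p (c ! (Suc k mod ?n)))"
    unfolding cycle_sign_def using c by (intro prod.cong refl edge) (simp add: is_cycle_def)
  also have "\<dots> = (\<Prod>k<?n. p (c ! k)) * (\<Prod>k<?n. p (c ! k))"
    unfolding prod.distrib prod_Suc_mod[of "\<lambda>k. p (c ! k)"] by (rule refl)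
  also have "\<dots> = (\<Prod>k<?n. p (c ! k) * p (c ! k))" by (rule prod.distrib[symmetric])
  also have "\<dots> = 1" by (simp add: p)
  finally show "0 < cycle_sign ?\<Gamma> c" by simp
qed

text \<open>Harary's theorem for the incidence graph: a shortest negative closed walk becomes a
  cycle once lengths 1 and 2 are excluded.\<close>

lemma potential_if_balanced:
  assumes bal: "balanced (signed_incidence_graph i K \<omega>)"
  shows "\<exists>p. incidence_potential i K \<omega> p"
proof -
  let ?\<Gamma> = "signed_incidence_graph i K \<omega>"
  let ?R = "\<lambda>x y s. {x, y} \<in> edges ?\<Gamma> \<and> s = edge_sign ?\<Gamma> {x, y}"
  interpret signed_relation ?R
  proof
    fix x y s assume "?R x y s"
    then show "?R y x s" by (simp add: insert_commute)
    show "s = 1 \<or> s = - 1"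
      using \<open>?R x y s\<close> incidence_sign_cases by (auto simp: signed_incidence_graph_def)
  qed
  have "\<not> walk x x n (- 1)" for x n
  proof
    assume "walk x x n (- 1)"
    then obtain f e n where n: "0 < n" "f n = f 0"
      and R: "\<And>k. k < n \<Longrightarrow> ?R (f k) (f (Suc k)) (e k)"
      and e: "(\<Prod>k<n. e k) = - 1" and inj: "inj_on f {..<n}"
      by (rule shortest_negative_closed_walk) (rule that)
    have "n \<noteq> 1"
    proof
      assume "n = 1"
      \<comment> \<open>A loop would be an edge \<open>{E, F}\<close> with
        \<open>E = F\<close>.\<close>
      then have "{f 0} \<in> edges ?\<Gamma>" using R[of 0] n by simp
      then show False unfolding edges_signed_incidence_graph by (metis doubleton_eq_iff insert_absorb2 psubset_eq)
    qed
    moreover have "n \<noteq> 2"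
    proof
      assume n2: "n = 2"
      \<comment> \<open>The same edge back and forth has a square as its sign.\<close>
      then have "e 0 = e 1"
        using R[of 0] R[of 1] n(2) by (simp add: insert_commute numeral_2_eq_2)
      moreover have "(\<Prod>k<n. e k) = e 0 * e 1" using n2 by (simp add: numeral_2_eq_2)
      ultimately show False using e by (metis not_one_le_zero neg_0_le_iff_le zero_le_square)
    qed
    ultimately have n3: "3 \<le> n" using n(1) by linarith
    define c where "c = map f [0..<n]"
    have len: "length c = n" by (simp add: c_def)
    have nth: "c ! k = f k" "c ! (Suc k mod n) = f (Suc k)" if "k < n" for k
      using that n(2) nth_map_closed[of k n f] by (simp_all add: c_def)
    have edges: "{c ! k, c ! (Suc k mod n)} \<in> edges ?\<Gamma>" if "k < n" for k
      using R[OF that] nth[OF that] by simp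
    have "distinct c"
      using inj by (simp add: c_def distinct_map lessThan_atLeast0)
    moreover have "set c \<subseteq> verts ?\<Gamma>"
    proof
      fix x assume "x \<in> set c"
      then obtain k where "k < n" "x = c ! k" using len by (metis in_set_conv_nth)
      with edges have "{x, c ! (Suc k mod n)} \<in> edges ?\<Gamma>" by blast
      then have "x \<in> faces i K \<union> faces (i + 1) K"
        unfolding edges_signed_incidence_graph by (auto simp: doubleton_eq_iff)
      then show "x \<in> verts ?\<Gamma>" by (simp add: signed_incidence_graph_def)
    qed
    ultimately have "is_cycle ?\<Gamma> c"
      using n3 edges by (simp add: is_cycle_def len)
    moreover have "cycle_sign ?\<Gamma> c = (\<Prod>k<n. e k)"
      unfolding cycle_sign_def len using R nth by (intro prod.cong) auto
    ultimately show False using bal e by (force simp: balanced_def)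
  qed
  from ex_potential[OF this] obtain p :: "'a set \<Rightarrow> int" where p: "\<forall>x. p x = 1 \<or> p x = - 1"
    "\<And>x y. {x, y} \<in> edges ?\<Gamma> \<Longrightarrow> edge_sign ?\<Gamma> {x, y} = p x * p y"
    by blast
  have "incidence_sign \<omega> E F = p E * p F"
    if "E \<in> faces i K" "F \<in> faces (i + 1) K" "E \<subset> F" for E F
  proof -
    have "{E, F} \<in> edges ?\<Gamma>" unfolding edges_signed_incidence_graph using that by blast
    then show ?thesis using p(2) edge_sign_incidence[OF that(3)] by metis
  qed
  with p(1) show ?thesis unfolding incidence_potential_def by blast
qed

lemma face_inter_psubset:
  assumes "F \<in> faces (i + 1) K" "F \<inter> G \<in> faces i K"
  shows "F \<inter> G \<subset> F"
proof -
  have "card (F \<inter> G) \<noteq> card F" using assms by (simp add: faces_def)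
  then show ?thesis by auto
qed

lemma incidence_potential_inter:
  assumes "incidence_potential i K \<omega> p" "F \<in> faces (i + 1) K" "F \<inter> G \<in> faces i K"
  shows "incidence_sign \<omega> (F \<inter> G) F = p (F \<inter> G) * p F"
  using assms(1,3,2) face_inter_psubset[OF assms(2,3)] unfolding incidence_potential_def by blast

text \<open>Distinct faces with \<open>i + 2\<close> vertices share at most \<open>i + 1\<close>, so
  a common i-face fills the intersection.\<close>

lemma face_inter_eq:
  assumes F: "F \<in> faces (i + 1) K" and G: "G \<in> faces (i + 1) K" and E: "E \<in> faces i K"
    and sub: "E \<subseteq> F" "E \<subseteq> G" and "F \<noteq> G"
  shows "F \<inter> G = E"
proof -
  have fin: "finite F" "finite G"
    using F G by (auto simp: faces_def intro: card_ge_0_finite)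
  have "F \<inter> G \<noteq> F"
    using F G fin \<open>F \<noteq> G\<close> card_subset_eq[of G F] by (auto simp: faces_def)
  then have "card (F \<inter> G) < card F"
    using fin by (intro psubset_card_mono) auto
  then have "card (F \<inter> G) \<le> card E" using F E by (simp add: faces_def)
  then show ?thesis using sub fin card_seteq[of "F \<inter> G" E] by auto
qed

section \<open>Circuits and potentials\<close>

context
  fixes i :: nat and K :: "'a set set" and \<omega> :: "'a set \<Rightarrow> 'a list set"
  assumes K: "simplicial_complex K" and \<omega>: "orientation K \<omega>"
begin

text \<open>
  The twists \<open>q\<close> are indexed by positions because a circuit of length 4 may visit a face twice.
  Any choice of a position for each face works: adjacency of two faces makes all of their
  positions consecutive.
\<close>

lemma orientable_circuitI:
  assumes circ: "face_circuit i K Fs" and q: "\<And>j. q j = 1 \<or> q j = (- 1 :: int)"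
    and opp: "\<And>j l. j < length Fs \<Longrightarrow> l = Suc j mod length Fs \<Longrightarrow>
      q j * incidence_sign \<omega> (Fs ! j \<inter> Fs ! l) (Fs ! j) =
        - (q l * incidence_sign \<omega> (Fs ! j \<inter> Fs ! l) (Fs ! l))"
  shows "orientable i (generated_complex (set Fs))"
proof -
  have sub: "set Fs \<subseteq> faces (i + 1) K"
    and adj: "\<And>j l. j < length Fs \<Longrightarrow> l < length Fs \<Longrightarrow> Fs ! j \<inter> Fs ! l \<in> faces i K \<Longrightarrow>
      l = Suc j mod length Fs \<or> j = Suc l mod length Fs"
    using circ unfolding face_circuit_def by blast+
  define pos where "pos F = (SOME j. j < length Fs \<and> Fs ! j = F)" for F
  have pos: "pos F < length Fs \<and> Fs ! pos F = F" if "F \<in> set Fs" for F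
    unfolding pos_def by (rule someI_ex) (use that in \<open>simp add: in_set_conv_nth\<close>)
  have "q (pos F) * incidence_sign \<omega> (F \<inter> G) F = - (q (pos G) * incidence_sign \<omega> (F \<inter> G) G)"
    if FG: "F \<in> set Fs" "G \<in> set Fs" "F \<inter> G \<in> faces i K" for F G
  proof -
    note posF = pos[OF FG(1), THEN conjunct1] pos[OF FG(1), THEN conjunct2]
    note posG = pos[OF FG(2), THEN conjunct1] pos[OF FG(2), THEN conjunct2]
    from adj[OF posF(1) posG(1), unfolded posF(2) posG(2), OF FG(3)] show ?thesis
    proof
      assume "pos G = Suc (pos F) mod length Fs"
      from opp[OF posF(1) this] show ?thesis unfolding posF(2) posG(2) .
    next
      assume "pos F = Suc (pos G) mod length Fs"
      from opp[OF posG(1) this] show ?thesis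
        unfolding posF(2) posG(2) Int_commute[of G F] by linarith
    qed
  qed
  then show ?thesis
    unfolding orientable_generated_iff[OF K \<omega> sub] using q by (intro exI[of _ "q \<circ> pos"]) simp
qed

text \<open>The product \<open>t F * p F\<close> is a 2-colouring: it changes sign between adjacent
  faces.\<close>

lemma orientable_circuit_even:
  assumes circ: "face_circuit i K Fs" and ori: "orientable i (generated_complex (set Fs))"
    and pot: "incidence_potential i K \<omega> p"
  shows "even (length Fs)"
proof -
  let ?n = "length Fs"
  have ne: "?n > 0" and sub: "set Fs \<subseteq> faces (i + 1) K"
    and adj: "\<And>j. j < ?n \<Longrightarrow> Fs ! j \<inter> Fs ! (Suc j mod ?n) \<in> faces i K"
    using circ unfolding face_circuit_def by auto
  obtain t where t: "\<And>F. t F = 1 \<or> t F = (- 1 :: int)"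
    and opp: "\<And>F G. F \<in> set Fs \<Longrightarrow> G \<in> set Fs \<Longrightarrow> F \<inter> G \<in> faces i K \<Longrightarrow>
      t F * incidence_sign \<omega> (F \<inter> G) F = - (t G * incidence_sign \<omega> (F \<inter> G) G)"
    using ori unfolding orientable_generated_iff[OF K \<omega> sub] by blast
  define r where "r F = t F * p F" for F
  have p: "p F = 1 \<or> p F = - 1" for F using pot by (simp add: incidence_potential_def)
  have r: "r F = 1 \<or> r F = - 1" for F using t[of F] p[of F] by (auto simp: r_def)
  have step: "r F = - r G" if "F \<in> set Fs" "G \<in> set Fs" "F \<inter> G \<in> faces i K" for F G
  proof -
    have "incidence_sign \<omega> (F \<inter> G) F = p (F \<inter> G) * p F"
      using incidence_potential_inter[OF pot] that sub by blast
    moreover have "incidence_sign \<omega> (F \<inter> G) G = p (F \<inter> G) * p G"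
      using incidence_potential_inter[OF pot, of G F] that sub by (auto simp: Int_commute)
    ultimately show ?thesis
      using opp[OF that] p[of "F \<inter> G"] by (auto simp: r_def)
  qed
  \<comment> \<open>Shifting the circuit by one step preserves the product of the colours but
    changes the sign of each factor.\<close>
  have "(\<Prod>k<?n. r (Fs ! k)) = (\<Prod>k<?n. - 1 * r (Fs ! (Suc k mod ?n)))"
    using step adj ne by (intro prod.cong) auto
  also have "\<dots> = (- 1) ^ ?n * (\<Prod>k<?n. r (Fs ! k))"
    unfolding prod.distrib prod_Suc_mod[of "\<lambda>k. r (Fs ! k)"] by simp
  finally have eq: "(\<Prod>k<?n. r (Fs ! k)) = (- 1) ^ ?n * (\<Prod>k<?n. r (Fs ! k))" .
  have "r F \<noteq> 0" for F using r[of F] by auto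
  then have "(\<Prod>k<?n. r (Fs ! k)) \<noteq> 0" by simp
  with eq have "(- 1 :: int) ^ ?n = 1" by simp
  then show ?thesis by (simp add: minus_one_power_iff split: if_splits)
qed

lemma even_circuit_orientable:
  assumes circ: "face_circuit i K Fs" and even: "even (length Fs)"
    and pot: "incidence_potential i K \<omega> p"
  shows "orientable i (generated_complex (set Fs))"
proof (rule orientable_circuitI[OF circ])
  have p: "p F = 1 \<or> p F = - 1" for F using pot by (simp add: incidence_potential_def)
  \<comment> \<open>The factor \<open>p\<close> makes the induced orientations agree; the
    alternating factor turns agreement into opposition.\<close>
  define q where "q j = (- 1) ^ j * p (Fs ! j)" for j
  show "q j = 1 \<or> q j = - 1" for j
    using p[of "Fs ! j"] by (auto simp: q_def minus_one_power_iff)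
  fix j l
  assume j: "j < length Fs" and l: "l = Suc j mod length Fs"
  then have l_less: "l < length Fs" by (metis length_greater_0_conv list.size(3) mod_less_divisor not_less0)
  define F G where "F = Fs ! j" and "G = Fs ! l"
  have FG: "F \<in> faces (i + 1) K" "G \<in> faces (i + 1) K" "F \<inter> G \<in> faces i K"
    using circ j l l_less nth_mem[OF j] nth_mem[OF l_less]
    unfolding face_circuit_def F_def G_def by blast+
  have "incidence_sign \<omega> (F \<inter> G) F = p (F \<inter> G) * p F"
    using incidence_potential_inter[OF pot] FG by blast
  moreover have "incidence_sign \<omega> (F \<inter> G) G = p (F \<inter> G) * p G"
    using incidence_potential_inter[OF pot, of G F] FG by (simp add: Int_commute)
  moreover have "(- 1 :: int) ^ l = - ((- 1) ^ j)"
  proof (cases "Suc j = length Fs")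
    \<comment> \<open>At the closing step \<open>l = 0\<close>, and even length makes the last
      position odd.\<close>
    case True
    then have "odd j" using even by (metis even_Suc)
    with True show ?thesis by (simp add: l)
  qed (use j in \<open>auto simp: l\<close>)
  ultimately have "q j * incidence_sign \<omega> (F \<inter> G) F = - (q l * incidence_sign \<omega> (F \<inter> G) G)"
    using p[of F] p[of G] by (auto simp: q_def simp flip: F_def G_def)
  then show "q j * incidence_sign \<omega> (Fs ! j \<inter> Fs ! l) (Fs ! j) =
      - (q l * incidence_sign \<omega> (Fs ! j \<inter> Fs ! l) (Fs ! l))"
    unfolding F_def G_def .
qed

lemma potential_if_circuits:
  assumes odd: "\<And>Fs. orientable_circuit i K Fs \<Longrightarrow> even (length Fs)"
    and even: "\<And>Fs. non_orientable_circuit i K Fs \<Longrightarrow> odd (length Fs)"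
  shows "\<exists>p. incidence_potential i K \<omega> p"
proof -
  let ?\<sigma> = "incidence_sign \<omega>"
  \<comment> \<open>The sign of a step is that of the path \<open>F\<close>, \<open>E\<close>,
    \<open>G\<close> in the incidence graph. Loops \<open>F = G\<close> occur, with sign 1.\<close>
  let ?R = "\<lambda>F G s. F \<in> faces (i + 1) K \<and> G \<in> faces (i + 1) K \<and>
    (\<exists>E\<in>faces i K. E \<subset> F \<and> E \<subset> G \<and> s = ?\<sigma> E F * ?\<sigma> E G)"
  have sgn: "?\<sigma> E F * ?\<sigma> E G = 1 \<or> ?\<sigma> E F * ?\<sigma> E G = - 1" for E F G
    using incidence_sign_cases[of \<omega> E F] incidence_sign_cases[of \<omega> E G] by auto
  interpret signed_relation ?R
  proof
    fix F G s assume R: "?R F G s"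
    then show "?R G F s" by (auto simp: mult.commute)
    show "s = 1 \<or> s = - 1" using R sgn by blast
  qed
  have "\<not> walk x x n (- 1)" for x n
  proof
    assume "walk x x n (- 1)"
    then obtain f e n where n: "0 < n" "f n = f 0"
      and R: "\<And>k. k < n \<Longrightarrow> ?R (f k) (f (Suc k)) (e k)"
      and e: "(\<Prod>k<n. e k) = - 1" and inj: "inj_on f {..<n}"
      and chord: "\<And>j l t. j < l \<Longrightarrow> l < n \<Longrightarrow> ?R (f j) (f l) t \<Longrightarrow> l = Suc j \<or> j = 0 \<and> Suc l = n"
      by (rule shortest_negative_closed_walk) (rule that)
    have n1: "n \<noteq> 1"
    proof
      assume n1: "n = 1"
      then have "e 0 = 1" using R[of 0] n(2) by auto
      then show False using e n1 by simp
    qed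
    have step_ne: "f k \<noteq> f (Suc k)" if "k < n" for k
    proof (cases "Suc k = n")
      case True
      \<comment> \<open>The closing step returns to \<open>f 0\<close>; injectivity below
        \<open>n\<close> applies to \<open>k\<close> and 0.\<close>
      then have "k \<noteq> 0" using n1 by auto
      then show ?thesis using inj_onD[OF inj, of k 0] that True n by auto
    next
      case False
      then show ?thesis using inj_onD[OF inj, of k "Suc k"] that by auto
    qed
    have step: "f k \<inter> f (Suc k) \<in> faces i K"
      "e k = ?\<sigma> (f k \<inter> f (Suc k)) (f k) * ?\<sigma> (f k \<inter> f (Suc k)) (f (Suc k))" if k: "k < n" for k
    proof -
      obtain E where E: "E \<in> faces i K" "E \<subset> f k" "E \<subset> f (Suc k)"
        "e k = ?\<sigma> E (f k) * ?\<sigma> E (f (Suc k))"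
        using R[OF k] by blast
      moreover have "f k \<inter> f (Suc k) = E"
        by (rule face_inter_eq) (use R[OF k] E step_ne[OF k] in auto)
      ultimately show "f k \<inter> f (Suc k) \<in> faces i K"
        "e k = ?\<sigma> (f k \<inter> f (Suc k)) (f k) * ?\<sigma> (f k \<inter> f (Suc k)) (f (Suc k))"
        by simp_all
    qed
    have faces: "f k \<in> faces (i + 1) K" if "k < n" for k using R[OF that] by blast
    define Fs where "Fs = map f [0..<n]"
    have len: "length Fs = n" by (simp add: Fs_def)
    have nth: "Fs ! k = f k" "Fs ! (Suc k mod n) = f (Suc k)" if "k < n" for k
      using that n(2) nth_map_closed[of k n f] by (simp_all add: Fs_def)
    \<comment> \<open>The pair exempted in \<open>chord\<close>, first and last position, is
      adjacent cyclically.\<close>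
    have adj1: "l = Suc j mod n \<or> j = Suc l mod n"
      if "j < l" "l < n" "f j \<inter> f l \<in> faces i K" for j l
    proof -
      have "?R (f j) (f l) (?\<sigma> (f j \<inter> f l) (f j) * ?\<sigma> (f j \<inter> f l) (f l))"
        using that faces[of j] faces[of l] face_inter_psubset[of "f j" i K "f l"]
          face_inter_psubset[of "f l" i K "f j"]
        by (auto simp: Int_commute)
      from chord[OF that(1,2) this] show ?thesis using that(2) by auto
    qed
    have adj: "f j \<inter> f l \<in> faces i K \<longleftrightarrow> l = Suc j mod n \<or> j = Suc l mod n"
      if jl: "j < n" "l < n" for j l
    proof
      assume FG: "f j \<inter> f l \<in> faces i K"
      \<comment> \<open>A top face meets itself in \<open>i + 2\<close> vertices, which is no
        i-face.\<close>
      have "j \<noteq> l" using FG faces[OF jl(1)] by (auto simp: faces_def)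
      then show "l = Suc j mod n \<or> j = Suc l mod n"
        using adj1[of j l] adj1[of l j] FG jl by (cases j l rule: linorder_cases) (auto simp: Int_commute)
    next
      assume "l = Suc j mod n \<or> j = Suc l mod n"
      then have "f l = f (Suc j) \<or> f j = f (Suc l)" using nth jl by metis
      then show "f j \<inter> f l \<in> faces i K" using step(1) jl by (auto simp: Int_commute)
    qed
    have circ: "face_circuit i K Fs"
      unfolding face_circuit_def len
    proof (intro conjI allI impI)
      show "Fs \<noteq> []" using n(1) len by auto
      show "set Fs \<subseteq> faces (i + 1) K" using faces by (auto simp: Fs_def)
      show "(Fs ! j \<inter> Fs ! l \<in> faces i K) = (l = Suc j mod n \<or> j = Suc l mod n)"
        if "j < n" "l < n" for j l
        using adj[OF that] nth(1) that by simp
    qed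
    show False
    proof (cases "Parity.even n")
      case True
      then have "orientable i (generated_complex (set Fs))"
        using even[of Fs] circ len by (auto simp: non_orientable_circuit_def)
      moreover have sub: "set Fs \<subseteq> faces (i + 1) K" using circ by (simp add: face_circuit_def)
      ultimately obtain t where t: "\<And>F. t F = 1 \<or> t F = (- 1 :: int)"
        and opp: "\<And>F G. F \<in> set Fs \<Longrightarrow> G \<in> set Fs \<Longrightarrow> F \<inter> G \<in> faces i K \<Longrightarrow>
          t F * ?\<sigma> (F \<inter> G) F = - (t G * ?\<sigma> (F \<inter> G) G)"
        unfolding orientable_generated_iff[OF K \<omega> sub] by blast
      \<comment> \<open>Orientability makes each step sign the negative of a product of neighbouring
        twists; around an even circuit everything cancels to 1.\<close>
      have "e k = - 1 * (t (Fs ! k) * t (Fs ! (Suc k mod n)))" if "k < n" for k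
      proof -
        have "f k \<in> set Fs" "f (Suc k) \<in> set Fs"
          using nth[OF that] len n(1) that by (metis nth_mem, metis mod_less_divisor nth_mem)
        from opp[OF this step(1)[OF that]] show ?thesis
          unfolding step(2)[OF that] nth[OF that]
          using t[of "f k"] t[of "f (Suc k)"]
            incidence_sign_cases[of \<omega> "f k \<inter> f (Suc k)" "f k"]
            incidence_sign_cases[of \<omega> "f k \<inter> f (Suc k)" "f (Suc k)"]
          by auto
      qed
      then have "(\<Prod>k<n. e k) = (\<Prod>k<n. - 1 * (t (Fs ! k) * t (Fs ! (Suc k mod n))))"
        by (intro prod.cong) auto
      also have "\<dots> = (- 1) ^ n * ((\<Prod>k<n. t (Fs ! k)) * (\<Prod>k<n. t (Fs ! k)))"
        unfolding prod.distrib prod_Suc_mod[of "\<lambda>k. t (Fs ! k)"] by simp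
      also have "\<dots> = (\<Prod>k<n. t (Fs ! k) * t (Fs ! k))"
        using True by (simp add: prod.distrib)
      also have "\<dots> = 1"
      proof (rule prod.neutral, rule ballI)
        show "t (Fs ! k) * t (Fs ! k) = 1" for k using t[of "Fs ! k"] by auto
      qed
      finally show False using e by simp
    next
      case False
      \<comment> \<open>Each twist is forced by the previous one, starting from 1: partial products
        of the negated step signs solve the opposition condition along the circuit.\<close>
      define q where "q j = (\<Prod>k<j. - e k)" for j
      have ecases: "e k = 1 \<or> e k = - 1" if "k < n" for k using R[OF that] sgn by blast
      have qcases: "q j = 1 \<or> q j = - 1" if "j \<le> n" for j
        using that
      proof (induction j)
        case (Suc j)
        then show ?case using ecases[of j] by (auto simp: q_def)
      qed (simp add: q_def)
      \<comment> \<open>Beyond \<open>n\<close> the values of \<open>e\<close> are unconstrained, so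
        1 serves as default.\<close>
      define q' where "q' j = (if j \<le> n then q j else 1)" for j
      \<comment> \<open>The twists close up since \<open>(- 1) ^ n\<close> and the sign of the walk
        are both \<open>- 1\<close>.\<close>
      have "q n = q 0"
        using e False by (simp add: q_def prod_uminus)
      then have qmod: "q (Suc j mod n) = q (Suc j)" if "j < n" for j
        using that by (cases "Suc j = n") auto
      have "orientable i (generated_complex (set Fs))"
      proof (rule orientable_circuitI[OF circ])
        show "q' j = 1 \<or> q' j = - 1" for j using qcases[of j] by (simp add: q'_def)
        fix j l
        assume "j < length Fs" and l: "l = Suc j mod length Fs"
        then have j: "j < n" by (simp add: len)
        have "q l = - (q j * e j)"
          using qmod[OF j] by (simp add: q_def l len)
        moreover have "l \<le> n" using n(1) by (simp add: l len less_imp_le)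
        ultimately have "q' l = - (q' j * e j)" using j by (simp add: q'_def)
        moreover have "Fs ! j = f j" "Fs ! l = f (Suc j)" using nth[OF j] by (simp_all add: l len)
        ultimately show "q' j * ?\<sigma> (Fs ! j \<inter> Fs ! l) (Fs ! j) =
            - (q' l * ?\<sigma> (Fs ! j \<inter> Fs ! l) (Fs ! l))"
          using step(2)[OF j] by (simp add: mult.assoc)
      qed
      then show False
        using odd[of Fs] circ len False by (auto simp: orientable_circuit_def)
    qed
  qed
  from ex_potential[OF this] obtain p :: "'a set \<Rightarrow> int" where p: "\<And>F. p F = 1 \<or> p F = - 1"
    and pR: "\<And>F G s. ?R F G s \<Longrightarrow> s = p F * p G"
    by blast
  \<comment> \<open>The potential on top faces extends to an i-face \<open>E\<close> through any top
    face \<open>up E\<close> above it. Since \<open>up E\<close> and \<open>F\<close> both contain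
    \<open>E\<close>, \<open>pR\<close> gives the required sign for every other \<open>F\<close>
    above \<open>E\<close>.\<close>
  define up where "up E = (SOME F. F \<in> faces (i + 1) K \<and> E \<subset> F)" for E
  define p' where "p' F = (if F \<in> faces (i + 1) K then p F else ?\<sigma> F (up F) * p (up F))" for F
  have "?\<sigma> E F = p' E * p' F" if EF: "E \<in> faces i K" "F \<in> faces (i + 1) K" "E \<subset> F" for E F
  proof -
    have up: "up E \<in> faces (i + 1) K \<and> E \<subset> up E"
      unfolding up_def by (rule someI[of _ F]) (use EF in blast)
    have "?\<sigma> E (up E) * ?\<sigma> E F = p (up E) * p F"
      by (rule pR) (use up EF in blast)
    moreover have "E \<notin> faces (i + 1) K" using EF(1) by (simp add: faces_def)
    ultimately show ?thesis
      using EF(2) p[of F] p[of "up E"] incidence_sign_cases[of \<omega> E "up E"]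
        incidence_sign_cases[of \<omega> E F]
      by (auto simp: p'_def)
  qed
  moreover have "p' F = 1 \<or> p' F = - 1" for F
    using p[of F] p[of "up F"] incidence_sign_cases[of \<omega> F "up F"] by (auto simp: p'_def)
  ultimately show ?thesis unfolding incidence_potential_def by blast
qed

end

theorem theorem3p4:
  fixes K :: "'a set set" and i :: nat and \<omega> :: "'a set \<Rightarrow> 'a list set"
  assumes "simplicial_complex K"
    and "face_path_connected i K"
    and "orientation K \<omega>"
  shows "balanced (signed_incidence_graph i K \<omega>) \<longleftrightarrow>
    (\<nexists>Fs. orientable_circuit i K Fs \<and> odd (length Fs)) \<and>
    (\<nexists>Fs. non_orientable_circuit i K Fs \<and> even (length Fs))"
    (is "?balanced \<longleftrightarrow> ?circuits")
proof
  assume ?balanced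
  then obtain p where p: "incidence_potential i K \<omega> p"
    using potential_if_balanced by blast
  show ?circuits
    using orientable_circuit_even[OF assms(1,3) _ _ p]
      even_circuit_orientable[OF assms(1,3) _ _ p]
    unfolding orientable_circuit_def non_orientable_circuit_def by blast
next
  assume ?circuits
  then obtain p where "incidence_potential i K \<omega> p"
    using potential_if_circuits[OF assms(1,3)] by blast
  then show ?balanced by (rule balanced_if_potential)
qed

end
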